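(* There is a linear extension of categories $$0\to D\to \mathbf{Nil}\to \mathbf{Nil}^\sim\to 0,$$ where $\mathbf{Nil}\to\mathbf{Nil}^\sim$ is the quotient functor and the bifunctor $D:(\mathbf{Nil}^\sim)^{\mathrm{op}}\times\mathbf{Nil}^\sim\to\mathbf{Ab}$ is given by $D(G,H)=\mathrm{Hom}(G^{\mathrm{ab}},[H,H])$.
   Context: Groups are written additively; $[a,b]=-a-b+a+b$. $\mathbf{Nil}$ is the category of groups of nilpotence class two (groups $G$ with $[[G,G],G]=0$) and homomorphisms; $\mathbf{Ab}$ is the category of abelian groups. $G^{\mathrm{ab}}=G/[G,G]$. A homomorphism $f:G\to H$ induces homomorphisms $f^{\mathrm{ab}}:G^{\mathrm{ab}}\to H^{\mathrm{ab}}$ and, by restriction, $[f,f]:[G,G]\to[H,H]$. For homomorphisms $f,g:G\to H$ write $f\sim g$ if $f^{\mathrm{ab}}=g^{\mathrm{ab}}$ and $[f,f]=[g,g]$. $\mathbf{Nil}^\sim$ is the quotient category with the same objects as $\mathbf{Nil}$ and with morphisms the $\sim$-classes of homomorphisms. $D$ is functorial via the maps induced on abelianizations and commutator subgroups. An element $k\in\mathrm{Hom}(G^{\mathrm{ab}},[H,H])$ acts on a homomorphism $f:G\to H$ by $f\mapsto f+jkp$ (pointwise sum), where $p:G\to G^{\mathrm{ab}}$ is the projection and $j:[H,H]\to H$ the inclusion. A linear extension of a category $\mathbf C$ by a bifunctor $D:\mathbf C^{\mathrm{op}}\times\mathbf C\to\mathbf{Ab}$, written $0\to D\to\mathbf E\xrightarrow{P}\mathbf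 C\to0$, is a full functor $P:\mathbf E\to\mathbf C$ which is the identity on objects ($\mathbf E$ and $\mathbf C$ have the same objects), together with, for all objects $i,j$, an action $(\alpha,a)\mapsto\alpha+a$ of the abelian group $D(i,j)$ on the set $\mathrm{Hom}_{\mathbf E}(i,j)$ which is transitive and free on each fibre of $P:\mathrm{Hom}_{\mathbf E}(i,j)\to\mathrm{Hom}_{\mathbf C}(i,j)$ (the fibres being preserved), satisfying the linear distributivity law $(\alpha+a)(\beta+b)=\alpha\beta+P(\alpha)_*b+P(\beta)^*a$ for composable $\alpha,\beta$. Set-theoretic size issues are disregarded. *)

theory Defs
  imports "HOL-Algebra.Generated_Groups" "HOL-Algebra.Group_Action"
begin

section \<open>Categories and functors\<close>

text \<open>
  Hom-sets are indexed by source and target and need not be disjoint, so composition and the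
  morphism part of a functor take the objects as arguments:
  \<open>Comp C X Y Z g f\<close> is the composite of \<open>f : X \<rightarrow> Y\<close> and \<open>g : Y \<rightarrow> Z\<close>.
\<close>

record ('o, 'm) cat =
  Obj :: "'o set"
  Hom :: "'o \<Rightarrow> 'o \<Rightarrow> 'm set"
  Comp :: "'o \<Rightarrow> 'o \<Rightarrow> 'o \<Rightarrow> 'm \<Rightarrow> 'm \<Rightarrow> 'm"
  Ident :: "'o \<Rightarrow> 'm"

locale category =
  fixes C :: "('o, 'm) cat"
  assumes Comp_in_Hom:
      "\<lbrakk>X \<in> Obj C; Y \<in> Obj C; Z \<in> Obj C; f \<in> Hom C X Y; g \<in> Hom C Y Z\<rbrakk>
        \<Longrightarrow> Comp C X Y Z g f \<in> Hom C X Z"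
    and Ident_in_Hom: "X \<in> Obj C \<Longrightarrow> Ident C X \<in> Hom C X X"
    and Comp_Ident_right:
      "\<lbrakk>X \<in> Obj C; Y \<in> Obj C; f \<in> Hom C X Y\<rbrakk> \<Longrightarrow> Comp C X X Y f (Ident C X) = f"
    and Comp_Ident_left:
      "\<lbrakk>X \<in> Obj C; Y \<in> Obj C; f \<in> Hom C X Y\<rbrakk> \<Longrightarrow> Comp C X Y Y (Ident C Y) f = f"
    and Comp_assoc:
      "\<lbrakk>W \<in> Obj C; X \<in> Obj C; Y \<in> Obj C; Z \<in> Obj C;
        f \<in> Hom C W X; g \<in> Hom C X Y; h \<in> Hom C Y Z\<rbrakk>
        \<Longrightarrow> Comp C W Y Z h (Comp C W X Y g f) = Comp C W X Z (Comp C X Y Z h g) f"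

record ('o, 'm, 'p, 'n) functor_data =
  FObj :: "'o \<Rightarrow> 'p"
  FMap :: "'o \<Rightarrow> 'o \<Rightarrow> 'm \<Rightarrow> 'n"

locale cat_functor = A: category A + B: category B
  for A :: "('o, 'm) cat" and B :: "('p, 'n) cat" +
  fixes F :: "('o, 'm, 'p, 'n) functor_data"
  assumes FObj_in_Obj: "X \<in> Obj A \<Longrightarrow> FObj F X \<in> Obj B"
    and FMap_in_Hom:
      "\<lbrakk>X \<in> Obj A; Y \<in> Obj A; f \<in> Hom A X Y\<rbrakk>
        \<Longrightarrow> FMap F X Y f \<in> Hom B (FObj F X) (FObj F Y)"
    and FMap_Ident: "X \<in> Obj A \<Longrightarrow> FMap F X X (Ident A X) = Ident B (FObj F X)"
    and FMap_Comp:
      "\<lbrakk>X \<in> Obj A; Y \<in> Obj A; Z \<in> Obj A; f \<in> Hom A X Y; g \<in> Hom A Y Z\<rbrakk>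
        \<Longrightarrow> FMap F X Z (Comp A X Y Z g f)
            = Comp B (FObj F X) (FObj F Y) (FObj F Z) (FMap F Y Z g) (FMap F X Y f)"

definition op_cat :: "('o, 'm) cat \<Rightarrow> ('o, 'm) cat" where
  "op_cat C =
    \<lparr>Obj = Obj C,
     Hom = (\<lambda>X Y. Hom C Y X),
     Comp = (\<lambda>X Y Z g f. Comp C Z Y X f g),
     Ident = Ident C\<rparr>"

definition prod_cat :: "('o, 'm) cat \<Rightarrow> ('p, 'n) cat \<Rightarrow> ('o \<times> 'p, 'm \<times> 'n) cat" where
  "prod_cat A B =
    \<lparr>Obj = Obj A \<times> Obj B,
     Hom = (\<lambda>X Y. Hom A (fst X) (fst Y) \<times> Hom B (snd X) (snd Y)),
     Comp = (\<lambda>X Y Z g f. (Comp A (fst X) (fst Y) (fst Z) (fst g) (fst f),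
                           Comp B (snd X) (snd Y) (snd Z) (snd g) (snd f))),
     Ident = (\<lambda>X. (Ident A (fst X), Ident B (snd X)))\<rparr>"

text \<open>
  Quotient of a category by a relation \<open>R X Y\<close> on each hom-set. The composite of two classes is
  the union of the classes of all composites of representatives; it is again a class when \<open>R\<close> is
  a congruence.
\<close>

definition quotient_cat ::
    "('o, 'm) cat \<Rightarrow> ('o \<Rightarrow> 'o \<Rightarrow> ('m \<times> 'm) set) \<Rightarrow> ('o, 'm set) cat" where
  "quotient_cat C R =
    \<lparr>Obj = Obj C,
     Hom = (\<lambda>X Y. Hom C X Y // R X Y),
     Comp = (\<lambda>X Y Z S T. \<Union>g\<in>S. \<Union>f\<in>T. R X Z `` {Comp C X Y Z g f}),
     Ident = (\<lambda>X. R X X `` {Ident C X})\<rparr>"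

definition quotient_functor ::
    "('o \<Rightarrow> 'o \<Rightarrow> ('m \<times> 'm) set) \<Rightarrow> ('o, 'm, 'o, 'm set) functor_data" where
  "quotient_functor R = \<lparr>FObj = (\<lambda>X. X), FMap = (\<lambda>X Y f. R X Y `` {f})\<rparr>"

text \<open>
  The full subcategory of groups (with carrier in the type \<open>'a\<close>) on a set of objects. Library
  homomorphisms are unconstrained off the carrier; extensionality makes equality of morphisms
  coincide with equality on the carrier.
\<close>

definition grp_cat :: "'a monoid set \<Rightarrow> ('a monoid, 'a \<Rightarrow> 'a) cat" where
  "grp_cat S =
    \<lparr>Obj = S,
     Hom = (\<lambda>G H. hom G H \<inter> extensional (carrier G)),
     Comp = (\<lambda>G H K g f. compose (carrier G) g f),
     Ident = (\<lambda>G. \<lambda>x\<in>carrier G. x)\<rparr>"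

definition ab_cat :: "('a monoid, 'a \<Rightarrow> 'a) cat" where
  "ab_cat = grp_cat {A. comm_group A}"


section \<open>Linear extensions of categories\<close>

text \<open>
  \<open>act X Y f a\<close> is \<open>f + a\<close> for \<open>a \<in> D(X,Y)\<close>. The groups \<open>D(X,Y)\<close> are written
  multiplicatively, as everywhere in HOL-Algebra.
\<close>

locale linear_extension =
  D: cat_functor "prod_cat (op_cat C) C" ab_cat D + P: cat_functor E C P
  for D :: "('o \<times> 'o, 'n \<times> 'n, 'd monoid, 'd \<Rightarrow> 'd) functor_data"
    and E :: "('o, 'm) cat"
    and C :: "('o, 'n) cat"
    and P :: "('o, 'm, 'o, 'n) functor_data"
    and act :: "'o \<Rightarrow> 'o \<Rightarrow> 'm \<Rightarrow> 'd \<Rightarrow> 'm" +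
  assumes same_objects: "Obj E = Obj C"
    and identity_on_objects: "X \<in> Obj E \<Longrightarrow> FObj P X = X"
    and full: "\<lbrakk>X \<in> Obj E; Y \<in> Obj E\<rbrakk> \<Longrightarrow> FMap P X Y ` Hom E X Y = Hom C X Y"
    and action:
      "\<lbrakk>X \<in> Obj E; Y \<in> Obj E\<rbrakk>
        \<Longrightarrow> group_action (FObj D (X, Y)) (Hom E X Y) (\<lambda>a. \<lambda>f\<in>Hom E X Y. act X Y f a)"
    and fibre_preserved:
      "\<lbrakk>X \<in> Obj E; Y \<in> Obj E; f \<in> Hom E X Y; a \<in> carrier (FObj D (X, Y))\<rbrakk>
        \<Longrightarrow> FMap P X Y (act X Y f a) = FMap P X Y f"
    and fibre_transitive:
      "\<lbrakk>X \<in> Obj E; Y \<in> Obj E; f \<in> Hom E X Y; g \<in> Hom E X Y; FMap P X Y f = FMap P X Y g\<rbrakk>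
        \<Longrightarrow> \<exists>a\<in>carrier (FObj D (X, Y)). act X Y f a = g"
    and fibre_free:
      "\<lbrakk>X \<in> Obj E; Y \<in> Obj E; f \<in> Hom E X Y; a \<in> carrier (FObj D (X, Y)); act X Y f a = f\<rbrakk>
        \<Longrightarrow> a = \<one>\<^bsub>FObj D (X, Y)\<^esub>"
    and linear_distributivity:
      "\<lbrakk>X \<in> Obj E; Y \<in> Obj E; Z \<in> Obj E; \<beta> \<in> Hom E X Y; \<alpha> \<in> Hom E Y Z;
        b \<in> carrier (FObj D (X, Y)); a \<in> carrier (FObj D (Y, Z))\<rbrakk>
        \<Longrightarrow> Comp E X Y Z (act Y Z \<alpha> a) (act X Y \<beta> b)
            = act X Z (Comp E X Y Z \<alpha> \<beta>)
                (FMap D (X, Y) (X, Z) (Ident C X, FMap P Y Z \<alpha>) b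
                 \<otimes>\<^bsub>FObj D (X, Z)\<^esub> FMap D (Y, Z) (X, Z) (FMap P X Y \<beta>, Ident C Z) a)"


section \<open>Groups of nilpotence class two\<close>

definition commutator :: "('a, 'b) monoid_scheme \<Rightarrow> 'a \<Rightarrow> 'a \<Rightarrow> 'a" where
  "commutator G a b = inv\<^bsub>G\<^esub> a \<otimes>\<^bsub>G\<^esub> inv\<^bsub>G\<^esub> b \<otimes>\<^bsub>G\<^esub> a \<otimes>\<^bsub>G\<^esub> b"

definition commutator_subgroup :: "('a, 'b) monoid_scheme \<Rightarrow> 'a set \<Rightarrow> 'a set \<Rightarrow> 'a set" where
  "commutator_subgroup G H K = generate G {commutator G a b | a b. a \<in> H \<and> b \<in> K}"

abbreviation comm_sub :: "('a, 'b) monoid_scheme \<Rightarrow> 'a set" where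
  "comm_sub G \<equiv> commutator_subgroup G (carrier G) (carrier G)"

text \<open>
  The library's derived subgroup is generated by the elements \<open>[-a,-b]\<close> in the present
  convention for commutators, hence is the same subgroup.
\<close>

lemma (in group) comm_sub_eq_derived: "comm_sub G = derived G (carrier G)"
proof -
  have "{commutator G a b | a b. a \<in> carrier G \<and> b \<in> carrier G} = derived_set G (carrier G)"
  proof (intro equalityI subsetI)
    fix x assume "x \<in> {commutator G a b | a b. a \<in> carrier G \<and> b \<in> carrier G}"
    then obtain a b where ab: "a \<in> carrier G" "b \<in> carrier G" "x = commutator G a b"
      by blast
    then have "x = inv a \<otimes> inv b \<otimes> inv (inv a) \<otimes> inv (inv b)"
      by (simp add: commutator_def)
    with ab(1,2) show "x \<in> derived_set G (carrier G)"
      by blast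
  next
    fix x assume "x \<in> derived_set G (carrier G)"
    then obtain a b where ab: "a \<in> carrier G" "b \<in> carrier G"
        "x = a \<otimes> b \<otimes> inv a \<otimes> inv b"
      by blast
    then have "x = commutator G (inv a) (inv b)"
      by (simp add: commutator_def)
    with ab(1,2) show "x \<in> {commutator G a b | a b. a \<in> carrier G \<and> b \<in> carrier G}"
      by blast
  qed
  then show ?thesis
    by (simp add: commutator_subgroup_def derived_def)
qed

definition nil2_group :: "'a monoid \<Rightarrow> bool" where
  "nil2_group G \<longleftrightarrow> group G \<and> commutator_subgroup G (comm_sub G) (carrier G) = {\<one>\<^bsub>G\<^esub>}"

definition nil_cat :: "('a monoid, 'a \<Rightarrow> 'a) cat" where
  "nil_cat = grp_cat {G. nil2_group G}"

definition abelianization :: "'a monoid \<Rightarrow> 'a set monoid" where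
  "abelianization G = G Mod (comm_sub G)"

definition ab_proj :: "'a monoid \<Rightarrow> 'a \<Rightarrow> 'a set" where
  "ab_proj G x = comm_sub G #>\<^bsub>G\<^esub> x"

text \<open>The coset \<open>X\<close> is sent to the coset \<open>[H,H] + f(X)\<close>.\<close>

definition ab_map :: "'a monoid \<Rightarrow> 'a monoid \<Rightarrow> ('a \<Rightarrow> 'a) \<Rightarrow> 'a set \<Rightarrow> 'a set" where
  "ab_map G H f = (\<lambda>X\<in>carrier (abelianization G). comm_sub H <#>\<^bsub>H\<^esub> (f ` X))"

definition comm_map :: "'a monoid \<Rightarrow> ('a \<Rightarrow> 'a) \<Rightarrow> 'a \<Rightarrow> 'a" where
  "comm_map G f = restrict f (comm_sub G)"

definition nil_sim :: "'a monoid \<Rightarrow> 'a monoid \<Rightarrow> (('a \<Rightarrow> 'a) \<times> ('a \<Rightarrow> 'a)) set" where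
  "nil_sim G H = {(f, g). f \<in> Hom nil_cat G H \<and> g \<in> Hom nil_cat G H \<and>
                    ab_map G H f = ab_map G H g \<and> comm_map G f = comm_map G g}"

definition nil_sim_cat :: "('a monoid, ('a \<Rightarrow> 'a) set) cat" where
  "nil_sim_cat = quotient_cat nil_cat nil_sim"


section \<open>The bifunctor\<close>

definition hom_group :: "'a monoid \<Rightarrow> 'b monoid \<Rightarrow> ('a \<Rightarrow> 'b) monoid" where
  "hom_group A B =
    \<lparr>carrier = hom A B \<inter> extensional (carrier A),
     mult = (\<lambda>f g. \<lambda>x\<in>carrier A. f x \<otimes>\<^bsub>B\<^esub> g x),
     one = (\<lambda>x\<in>carrier A. \<one>\<^bsub>B\<^esub>)\<rparr>"

text \<open>
  The maps induced by a \<open>\<sim>\<close>-class: \<open>f\<^sup>a\<^sup>b\<close> and \<open>[f,f]\<close> take a single value on the class.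
\<close>

definition class_ab_map ::
    "'a monoid \<Rightarrow> 'a monoid \<Rightarrow> ('a \<Rightarrow> 'a) set \<Rightarrow> 'a set \<Rightarrow> 'a set" where
  "class_ab_map G H S = the_elem (ab_map G H ` S)"

definition class_comm_map :: "'a monoid \<Rightarrow> ('a \<Rightarrow> 'a) set \<Rightarrow> 'a \<Rightarrow> 'a" where
  "class_comm_map G S = the_elem (comm_map G ` S)"

lemma class_maps:
  assumes "f \<in> Hom nil_cat G H"
  shows "class_ab_map G H (nil_sim G H `` {f}) = ab_map G H f"
    and "class_comm_map G (nil_sim G H `` {f}) = comm_map G f"
proof -
  have "ab_map G H ` (nil_sim G H `` {f}) = {ab_map G H f}"
    using assms by (auto simp: nil_sim_def)
  then show "class_ab_map G H (nil_sim G H `` {f}) = ab_map G H f"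
    by (simp add: class_ab_map_def)
  have "comm_map G ` (nil_sim G H `` {f}) = {comm_map G f}"
    using assms by (auto simp: nil_sim_def)
  then show "class_comm_map G (nil_sim G H `` {f}) = comm_map G f"
    by (simp add: class_comm_map_def)
qed

definition nil_D_obj :: "'a monoid \<times> 'a monoid \<Rightarrow> ('a set \<Rightarrow> 'a) monoid" where
  "nil_D_obj = (\<lambda>(G, H). hom_group (abelianization G) (H\<lparr>carrier := comm_sub H\<rparr>))"

text \<open>
  For \<open>S\<close> the class of \<open>\<alpha> : G' \<rightarrow> G\<close> and \<open>T\<close> the class of \<open>\<beta> : H \<rightarrow> H'\<close>, the induced map
  \<open>D(G,H) \<rightarrow> D(G',H')\<close> sends \<open>k\<close> to \<open>[\<beta>,\<beta>] k \<alpha>\<^sup>a\<^sup>b\<close>.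
\<close>

definition nil_D ::
    "('a monoid \<times> 'a monoid, ('a \<Rightarrow> 'a) set \<times> ('a \<Rightarrow> 'a) set,
      ('a set \<Rightarrow> 'a) monoid, ('a set \<Rightarrow> 'a) \<Rightarrow> 'a set \<Rightarrow> 'a) functor_data" where
  "nil_D =
    \<lparr>FObj = nil_D_obj,
     FMap = (\<lambda>(G, H) (G', H') (S, T).
       \<lambda>k\<in>carrier (nil_D_obj (G, H)).
         \<lambda>z\<in>carrier (abelianization G'). class_comm_map H T (k (class_ab_map G' G S z)))\<rparr>"

definition nil_act ::
    "'a monoid \<Rightarrow> 'a monoid \<Rightarrow> ('a \<Rightarrow> 'a) \<Rightarrow> ('a set \<Rightarrow> 'a) \<Rightarrow> 'a \<Rightarrow> 'a" where
  "nil_act G H f k = (\<lambda>x\<in>carrier G. f x \<otimes>\<^bsub>H\<^esub> k (ab_proj G x))"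

end

theory Submission
  imports Defs
begin

text \<open>
  In a group of class two, commutators are central. Hence \<open>x \<mapsto> f(x) + k(p(x))\<close> is again a
  homomorphism, and it is equivalent to \<open>f\<close> because \<open>k p\<close> takes values in \<open>[H,H]\<close> and vanishes on
  \<open>[G,G]\<close>. Conversely, if \<open>f \<sim> g\<close>, then \<open>x \<mapsto> -f(x) + g(x)\<close> takes values in \<open>[H,H]\<close>, is
  additive by centrality, vanishes on \<open>[G,G]\<close>, and so factors through \<open>G\<^sup>a\<^sup>b\<close>. Linear
  distributivity follows by evaluating both sides: \<open>\<alpha>\<close> is additive, and \<open>a\<close> does not see the
  summand \<open>b\<close>, which lies in a commutator subgroup.
\<close>

section \<open>Constructions on categories\<close>

lemma category_op_cat:
  assumes "category C"
  shows "category (op_cat C)"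
proof -
  interpret category C by fact
  show ?thesis
    by unfold_locales
      (simp_all add: op_cat_def Comp_in_Hom Ident_in_Hom Comp_Ident_right Comp_Ident_left Comp_assoc)
qed

lemma category_prod_cat:
  assumes "category A" and "category B"
  shows "category (prod_cat A B)"
proof -
  interpret A: category A by fact
  interpret B: category B by fact
  show ?thesis
    by unfold_locales
      (auto simp: prod_cat_def A.Comp_in_Hom A.Ident_in_Hom A.Comp_Ident_right A.Comp_Ident_left
        A.Comp_assoc B.Comp_in_Hom B.Ident_in_Hom B.Comp_Ident_right B.Comp_Ident_left B.Comp_assoc)
qed

text \<open>Since carriers are closed under multiplication, a homomorphism restricted to its carrier
  stays multiplicative, and the category laws hold as equalities of functions.\<close>

lemma category_grp_cat:
  assumes "\<And>G. G \<in> S \<Longrightarrow> group G"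
  shows "category (grp_cat S)"
proof
  fix W X Y Z :: "'a monoid" and f g h
  assume "f \<in> Hom (grp_cat S) W X" "g \<in> Hom (grp_cat S) X Y" "h \<in> Hom (grp_cat S) Y Z"
  then show "Comp (grp_cat S) W Y Z h (Comp (grp_cat S) W X Y g f)
      = Comp (grp_cat S) W X Z (Comp (grp_cat S) X Y Z h g) f"
    by (auto simp: grp_cat_def compose_def hom_def fun_eq_iff)
next
  fix X Y Z :: "'a monoid" and f g
  assume "X \<in> Obj (grp_cat S)" "f \<in> Hom (grp_cat S) X Y" "g \<in> Hom (grp_cat S) Y Z"
  then show "Comp (grp_cat S) X Y Z g f \<in> Hom (grp_cat S) X Z"
    using assms[THEN group.is_monoid, THEN monoid.m_closed]
    by (auto simp: grp_cat_def hom_def compose_eq Pi_iff)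
next
  fix X :: "'a monoid"
  assume "X \<in> Obj (grp_cat S)"
  then interpret group X
    using assms by (simp add: grp_cat_def)
  show "Ident (grp_cat S) X \<in> Hom (grp_cat S) X X"
    by (auto simp: grp_cat_def hom_def)
qed (auto simp: grp_cat_def compose_def hom_def extensional_def fun_eq_iff Pi_iff)

section \<open>Quotient of a category by a congruence\<close>

locale category_congruence = category C
  for C :: "('o, 'm) cat" and R :: "'o \<Rightarrow> 'o \<Rightarrow> ('m \<times> 'm) set" +
  assumes equiv_Hom: "\<lbrakk>X \<in> Obj C; Y \<in> Obj C\<rbrakk> \<Longrightarrow> equiv (Hom C X Y) (R X Y)"
    and Comp_congruent:
      "\<lbrakk>X \<in> Obj C; Y \<in> Obj C; Z \<in> Obj C; (f, f') \<in> R X Y; (g, g') \<in> R Y Z\<rbrakk>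
        \<Longrightarrow> (Comp C X Y Z g f, Comp C X Y Z g' f') \<in> R X Z"
begin

lemma class_in_Hom: "f \<in> Hom C X Y \<Longrightarrow> R X Y `` {f} \<in> Hom (quotient_cat C R) X Y"
  by (simp add: quotient_cat_def quotientI)

text \<open>Compatibility with composition makes the class of a composite independent of the
  representatives, so the union defining composition in the quotient is a union of equal
  sets.\<close>

lemma Comp_classes:
  assumes "X \<in> Obj C" "Y \<in> Obj C" "Z \<in> Obj C" "f \<in> Hom C X Y" "g \<in> Hom C Y Z"
  shows "Comp (quotient_cat C R) X Y Z (R Y Z `` {g}) (R X Y `` {f})
    = R X Z `` {Comp C X Y Z g f}"
proof -
  have "congruent2 (R Y Z) (R X Y) (\<lambda>g f. R X Z `` {Comp C X Y Z g f})"
    using assms equiv_Hom Comp_congruent by (auto simp: congruent2_def intro!: equiv_class_eq)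
  then show ?thesis
    using UN_equiv_class2[OF equiv_Hom equiv_Hom] assms by (simp add: quotient_cat_def)
qed

lemma Hom_classE:
  assumes "S \<in> Hom (quotient_cat C R) X Y"
  obtains f where "f \<in> Hom C X Y" "S = R X Y `` {f}"
  using assms by (auto simp: quotient_cat_def elim!: quotientE)

lemma Obj_quotient_cat: "Obj (quotient_cat C R) = Obj C"
  and Ident_quotient_cat: "Ident (quotient_cat C R) X = R X X `` {Ident C X}"
  by (simp_all add: quotient_cat_def)

sublocale quotient: category "quotient_cat C R"
  by unfold_locales
    (auto elim!: Hom_classE simp: Obj_quotient_cat Ident_quotient_cat Comp_classes class_in_Hom
      Comp_in_Hom Ident_in_Hom Comp_Ident_right Comp_Ident_left Comp_assoc)

sublocale quotient_functor: cat_functor C "quotient_cat C R" "quotient_functor R"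
  by unfold_locales
    (auto simp: quotient_functor_def Obj_quotient_cat Ident_quotient_cat Comp_classes class_in_Hom)

lemma quotient_functor_full: "FMap (quotient_functor R) X Y ` Hom C X Y = Hom (quotient_cat C R) X Y"
  by (auto simp: quotient_functor_def quotient_cat_def quotient_def)

end


section \<open>Abelianization and commutator subgroup\<close>

text \<open>
  The definitions of abelianization, \<open>G\<^sup>a\<^sup>b \<rightarrow> H\<^sup>a\<^sup>b\<close> and \<open>D\<close> require records of type \<open>'a monoid\<close>,
  whereas the library locale \<open>group\<close> allows further record fields.
\<close>

locale bare_group = group G for G :: "'a monoid" (structure)
begin

lemma normal_comm_sub: "comm_sub G \<lhd> G"
  by (simp add: comm_sub_eq_derived derived_self_is_normal)

lemma subgroup_comm_sub: "subgroup (comm_sub G) G"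
  using normal_comm_sub normal.axioms(1) by blast

lemma comm_sub_closed: "c \<in> comm_sub G \<Longrightarrow> c \<in> carrier G"
  using subgroup.mem_carrier[OF subgroup_comm_sub] .

lemma carrier_abelianization: "carrier (abelianization G) = ab_proj G ` carrier G"
  by (auto simp: abelianization_def carrier_FactGroup ab_proj_def)

lemma group_abelianization: "group (abelianization G)"
  unfolding abelianization_def by (rule normal.factorgroup_is_group[OF normal_comm_sub])

lemma ab_proj_hom: "ab_proj G \<in> hom G (abelianization G)"
  using normal.r_coset_hom_Mod[OF normal_comm_sub] by (simp add: abelianization_def ab_proj_def[abs_def])

text \<open>\<open>ab_proj G\<close> is a homomorphism with kernel \<open>comm_sub G\<close>. The
  form \<open>inv x \<otimes> y\<close> of the quotient suits the difference of two homomorphisms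
  taken later.\<close>

lemma ab_proj_eq_iff:
  assumes "x \<in> carrier G" "y \<in> carrier G"
  shows "ab_proj G x = ab_proj G y \<longleftrightarrow> inv x \<otimes> y \<in> comm_sub G"
proof -
  interpret p: group_hom G "abelianization G" "ab_proj G"
    by (simp add: group_hom_def group_hom_axioms_def is_group group_abelianization ab_proj_hom)
  have "ab_proj G x = ab_proj G y \<longleftrightarrow> ab_proj G (inv x \<otimes> y) = \<one>\<^bsub>abelianization G\<^esub>"
    using assms p.H.inv_solve_left[of "\<one>\<^bsub>abelianization G\<^esub>" "ab_proj G x" "ab_proj G y"] by auto
  also have "\<dots> \<longleftrightarrow> inv x \<otimes> y \<in> comm_sub G"
    using assms coset_join1[OF _ _ subgroup_comm_sub] coset_join2[OF _ subgroup_comm_sub]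
    by (auto simp: ab_proj_def abelianization_def)
  finally show ?thesis .
qed

lemma ab_proj_mult_comm_sub:
  assumes "x \<in> carrier G" "c \<in> comm_sub G"
  shows "ab_proj G (x \<otimes> c) = ab_proj G x"
proof -
  have "ab_proj G x = ab_proj G (x \<otimes> c)"
    using assms comm_sub_closed by (subst ab_proj_eq_iff) (auto simp flip: m_assoc)
  then show ?thesis by simp
qed

lemma abelianization_ext:
  assumes "k \<in> extensional (carrier (abelianization G))"
    and "l \<in> extensional (carrier (abelianization G))"
    and "\<And>x. x \<in> carrier G \<Longrightarrow> k (ab_proj G x) = l (ab_proj G x)"
  shows "k = l"
  using assms by (auto intro!: extensionalityI simp: carrier_abelianization)

end

section \<open>Maps induced by a homomorphism\<close>

locale bare_group_hom = group_hom G H h for G H :: "'a monoid" and h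
begin

sublocale G: bare_group G ..
sublocale H: bare_group H ..

text \<open>A homomorphism sends commutators to commutators, and the image of a generated subgroup
  is generated by the images of the generators.\<close>

lemma comm_sub_image:
  assumes "c \<in> comm_sub G"
  shows "h c \<in> comm_sub H"
proof -
  have "h ` comm_sub G = generate H (h ` {commutator G a b |a b. a \<in> carrier G \<and> b \<in> carrier G})"
    unfolding commutator_subgroup_def
    by (rule generate_img[symmetric]) (auto simp: commutator_def)
  also have "\<dots> \<subseteq> comm_sub H"
    unfolding commutator_subgroup_def
    by (rule H.mono_generate) (auto simp: commutator_def, metis hom_closed)
  finally show ?thesis using assms by blast
qed

text \<open>The image of the coset of \<open>x\<close> lies in the coset of \<open>h x\<close>
  because \<open>h\<close> respects commutator subgroups; multiplication by
  \<open>comm_sub H\<close> fills up that coset. So \<open>ab_map\<close> is the usual induced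
  map.\<close>

lemma ab_map_ab_proj:
  assumes "x \<in> carrier G"
  shows "ab_map G H h (ab_proj G x) = ab_proj H (h x)"
proof -
  interpret N: normal "comm_sub H" H by (rule H.normal_comm_sub)
  have "comm_sub H <#>\<^bsub>H\<^esub> h ` ab_proj G x = comm_sub H #>\<^bsub>H\<^esub> h x"
  proof
    show "comm_sub H <#>\<^bsub>H\<^esub> h ` ab_proj G x \<subseteq> comm_sub H #>\<^bsub>H\<^esub> h x"
    proof
      fix z assume "z \<in> comm_sub H <#>\<^bsub>H\<^esub> h ` ab_proj G x"
      then obtain d c where d: "d \<in> comm_sub H" and c: "c \<in> comm_sub G" and z: "z = d \<otimes>\<^bsub>H\<^esub> h (c \<otimes>\<^bsub>G\<^esub> x)"
        by (auto simp: set_mult_def ab_proj_def r_coset_def)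
      then have "z = (d \<otimes>\<^bsub>H\<^esub> h c) \<otimes>\<^bsub>H\<^esub> h x"
        using assms G.comm_sub_closed H.comm_sub_closed by (simp add: H.m_assoc)
      then show "z \<in> comm_sub H #>\<^bsub>H\<^esub> h x"
        using d comm_sub_image[OF c] by (auto simp: r_coset_def)
    qed
    \<comment> \<open>For this inclusion the single element \<open>x\<close> of its own coset
      suffices.\<close>
    show "comm_sub H #>\<^bsub>H\<^esub> h x \<subseteq> comm_sub H <#>\<^bsub>H\<^esub> h ` ab_proj G x"
      using G.rcos_self[OF assms G.subgroup_comm_sub]
      unfolding set_mult_def ab_proj_def r_coset_def[of H] by blast
  qed
  then show ?thesis
    using assms by (simp add: ab_map_def ab_proj_def G.carrier_abelianization)
qed

end


section \<open>The category of groups of class two\<close>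

lemma nil2_groupD: "nil2_group G \<Longrightarrow> bare_group G"
  by (simp add: nil2_group_def bare_group_def)

text \<open>The commutator of \<open>c\<close> and \<open>x\<close> lies in [[G,G],G], which is
  trivial.\<close>

lemma nil2_group_central:
  assumes "nil2_group G" "c \<in> comm_sub G" "x \<in> carrier G"
  shows "x \<otimes>\<^bsub>G\<^esub> c = c \<otimes>\<^bsub>G\<^esub> x"
proof -
  interpret bare_group G using assms(1) by (rule nil2_groupD)
  have c: "c \<in> carrier G" using assms comm_sub_closed by blast
  have "commutator G c x \<in> commutator_subgroup G (comm_sub G) (carrier G)"
    unfolding commutator_subgroup_def[of G "comm_sub G"] using assms by (blast intro: generate.incl)
  \<comment> \<open>The commutator is regrouped as a quotient of the two products to be
    compared.\<close>
  then have "inv\<^bsub>G\<^esub> (x \<otimes>\<^bsub>G\<^esub> c) \<otimes>\<^bsub>G\<^esub> (c \<otimes>\<^bsub>G\<^esub> x) = \<one>\<^bsub>G\<^esub>"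
    using assms c by (simp add: nil2_group_def commutator_def inv_mult_group m_assoc)
  then show ?thesis
    using assms c by (metis inv_equality inv_inv inv_closed m_closed)
qed

text \<open>Central elements commute with each other. This is what makes D(G,H) an abelian
  group.\<close>

lemma comm_group_comm_sub:
  assumes "nil2_group G"
  shows "comm_group (G\<lparr>carrier := comm_sub G\<rparr>)"
proof -
  interpret bare_group G using assms by (rule nil2_groupD)
  interpret N: group "G\<lparr>carrier := comm_sub G\<rparr>"
    using subgroup_comm_sub by (rule subgroup_imp_group)
  show ?thesis
    by unfold_locales (use nil2_group_central[OF assms] comm_sub_closed in auto)
qed

section \<open>Morphisms and the relation \<sim>\<close>

lemma nil_cat_simps:
  "Obj nil_cat = {G. nil2_group G}"
  "Hom nil_cat G H = hom G H \<inter> extensional (carrier G)"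
  "Comp nil_cat G H K g f = compose (carrier G) g f"
  "Ident nil_cat G = (\<lambda>x\<in>carrier G. x)"
  by (simp_all add: nil_cat_def grp_cat_def)

lemma nil_cat_group_hom:
  assumes "nil2_group G" "nil2_group H" "f \<in> Hom nil_cat G H"
  shows "bare_group_hom G H f"
  using assms by (simp add: nil_cat_simps nil2_groupD[unfolded bare_group_def]
    bare_group_hom_def group_hom_def group_hom_axioms_def)

text \<open>Every coset has a representative in \<open>G\<close> and \<open>ab_map\<close> is
  extensional, so equality of the induced maps can be tested on elements. Later proofs work with
  this pointwise form.\<close>

lemma nil_sim_iff:
  assumes "nil2_group G" "nil2_group H"
  shows "(f, g) \<in> nil_sim G H \<longleftrightarrow> f \<in> Hom nil_cat G H \<and> g \<in> Hom nil_cat G H \<and>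
    (\<forall>x\<in>carrier G. ab_proj H (f x) = ab_proj H (g x)) \<and> (\<forall>c\<in>comm_sub G. f c = g c)"
proof -
  have "ab_map G H f = ab_map G H g \<longleftrightarrow> (\<forall>x\<in>carrier G. ab_proj H (f x) = ab_proj H (g x))"
    if "f \<in> Hom nil_cat G H" "g \<in> Hom nil_cat G H"
  proof -
    interpret f: bare_group_hom G H f using assms that by (intro nil_cat_group_hom)
    interpret g: bare_group_hom G H g using assms that by (intro nil_cat_group_hom)
    have *: "ab_map G H h \<in> extensional (carrier (abelianization G))" for h
      by (simp add: ab_map_def)
    show ?thesis
    proof
      assume "ab_map G H f = ab_map G H g"
      then show "\<forall>x\<in>carrier G. ab_proj H (f x) = ab_proj H (g x)"
        by (metis f.ab_map_ab_proj g.ab_map_ab_proj)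
    next
      assume "\<forall>x\<in>carrier G. ab_proj H (f x) = ab_proj H (g x)"
      then show "ab_map G H f = ab_map G H g"
        by (intro f.G.abelianization_ext *) (simp add: f.ab_map_ab_proj g.ab_map_ab_proj)
    qed
  qed
  moreover have "comm_map G f = comm_map G g \<longleftrightarrow> (\<forall>c\<in>comm_sub G. f c = g c)"
    by (auto simp: comm_map_def restrict_def fun_eq_iff)
  ultimately show ?thesis by (auto simp: nil_sim_def)
qed

text \<open>The relation is equality of two induced maps, hence an equivalence; it respects
  composition because the maps induced by a composite are determined by those induced by its
  factors.\<close>

lemma category_congruence_nil: "category_congruence nil_cat nil_sim"
proof -
  interpret category nil_cat unfolding nil_cat_def by (rule category_grp_cat) (simp add: nil2_group_def)
  show ?thesis
  proof
    fix X Y :: "'a monoid"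
    show "equiv (Hom nil_cat X Y) (nil_sim X Y)"
      by (auto simp: nil_sim_def equiv_def refl_on_def sym_def trans_def)
  next
    fix X Y Z :: "'a monoid" and f f' g g'
    assume obj: "X \<in> Obj nil_cat" "Y \<in> Obj nil_cat" "Z \<in> Obj nil_cat"
      and sim: "(f, f') \<in> nil_sim X Y" "(g, g') \<in> nil_sim Y Z"
    have nil: "nil2_group X" "nil2_group Y" "nil2_group Z"
      using obj by (auto simp: nil_cat_simps)
    have hom: "f \<in> Hom nil_cat X Y" "f' \<in> Hom nil_cat X Y" "g \<in> Hom nil_cat Y Z" "g' \<in> Hom nil_cat Y Z"
      using sim by (auto simp: nil_sim_def)
    interpret f: bare_group_hom X Y f using nil hom by (intro nil_cat_group_hom)
    interpret f': bare_group_hom X Y f' using nil hom by (intro nil_cat_group_hom)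
    interpret g: bare_group_hom Y Z g using nil hom by (intro nil_cat_group_hom)
    interpret g': bare_group_hom Y Z g' using nil hom by (intro nil_cat_group_hom)
    have "ab_proj Z (g (f x)) = ab_proj Z (g' (f' x))" if x: "x \<in> carrier X" for x
    proof -
      \<comment> \<open>Passing through the abelianization of \<open>Y\<close> allows both
        replacements at once: \<open>g\<close> by \<open>g'\<close> in the induced map, and
        \<open>f x\<close> by \<open>f' x\<close> in the coset.\<close>
      have "ab_proj Z (g (f x)) = ab_map Y Z g (ab_proj Y (f x))"
        using x by (simp add: g.ab_map_ab_proj)
      also have "\<dots> = ab_map Y Z g' (ab_proj Y (f' x))"
        using sim x nil_sim_iff[OF nil(1,2), of f f'] by (simp add: nil_sim_def)
      also have "\<dots> = ab_proj Z (g' (f' x))"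
        using x by (simp add: g'.ab_map_ab_proj)
      finally show ?thesis .
    qed
    \<comment> \<open>On commutator subgroups: \<open>f\<close> and \<open>f'\<close> agree on [X,X]
      and map it into [Y,Y], where \<open>g\<close> and \<open>g'\<close> agree.\<close>
    then show "(Comp nil_cat X Y Z g f, Comp nil_cat X Y Z g' f') \<in> nil_sim X Z"
      using sim nil obj Comp_in_Hom[OF obj] hom f.G.comm_sub_closed f.comm_sub_image
      by (auto simp: nil_sim_iff nil_cat_simps(3) compose_eq)
  qed
qed

interpretation nil: category_congruence nil_cat nil_sim
  by (rule category_congruence_nil)


section \<open>The bifunctor\<close>

text \<open>Commutativity of \<open>B\<close> makes pointwise products and inverses of homomorphisms
  into homomorphisms.\<close>

lemma comm_group_hom_group:
  assumes "group A" "comm_group B"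
  shows "comm_group (hom_group A B)"
proof -
  interpret A: group A by fact
  interpret B: comm_group B by fact
  note defs = hom_group_def hom_def Pi_iff
  show ?thesis
  proof (rule comm_groupI)
    fix f assume f: "f \<in> carrier (hom_group A B)"
    have "(\<lambda>x\<in>carrier A. inv\<^bsub>B\<^esub> f x) \<in> carrier (hom_group A B)"
      using f by (auto simp: defs B.inv_mult)
    moreover have "(\<lambda>x\<in>carrier A. inv\<^bsub>B\<^esub> f x) \<otimes>\<^bsub>hom_group A B\<^esub> f = \<one>\<^bsub>hom_group A B\<^esub>"
      using f by (auto simp: defs fun_eq_iff)
    ultimately show "\<exists>g\<in>carrier (hom_group A B). g \<otimes>\<^bsub>hom_group A B\<^esub> f = \<one>\<^bsub>hom_group A B\<^esub>"
      by blast
  qed (auto simp: defs fun_eq_iff extensional_def B.m_ac)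
qed

section \<open>Elements of D(G,H) in terms of representatives\<close>

context bare_group
begin

text \<open>As \<open>ab_proj G\<close> is a surjective homomorphism, closure and additivity of
  \<open>k\<close> on cosets may be checked on representatives.\<close>

lemma nil_D_obj_carrier_iff:
  "k \<in> carrier (nil_D_obj (G, H)) \<longleftrightarrow>
    k \<in> extensional (carrier (abelianization G)) \<and>
    (\<forall>x\<in>carrier G. k (ab_proj G x) \<in> comm_sub H) \<and>
    (\<forall>x\<in>carrier G. \<forall>y\<in>carrier G.
      k (ab_proj G (x \<otimes> y)) = k (ab_proj G x) \<otimes>\<^bsub>H\<^esub> k (ab_proj G y))"
  using ab_proj_hom
  by (auto simp: nil_D_obj_def hom_group_def hom_def Pi_iff carrier_abelianization)

lemma nil_D_obj_mult:
  assumes "x \<in> carrier G"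
  shows "(k \<otimes>\<^bsub>nil_D_obj (G, H)\<^esub> l) (ab_proj G x) = k (ab_proj G x) \<otimes>\<^bsub>H\<^esub> l (ab_proj G x)"
  using assms by (simp add: nil_D_obj_def hom_group_def carrier_abelianization)

lemma nil_D_obj_one:
  assumes "x \<in> carrier G"
  shows "\<one>\<^bsub>nil_D_obj (G, H)\<^esub> (ab_proj G x) = \<one>\<^bsub>H\<^esub>"
  using assms by (simp add: nil_D_obj_def hom_group_def carrier_abelianization)

lemma nil_D_obj_ext:
  assumes "k \<in> carrier (nil_D_obj (G, H))" "l \<in> carrier (nil_D_obj (G, H))"
    and "\<And>x. x \<in> carrier G \<Longrightarrow> k (ab_proj G x) = l (ab_proj G x)"
  shows "k = l"
  using assms by (intro abelianization_ext) (auto simp: nil_D_obj_carrier_iff)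

end

section \<open>Functoriality of D\<close>

lemma comm_group_nil_D_obj:
  assumes "nil2_group G" "nil2_group H"
  shows "comm_group (nil_D_obj (G, H))"
  using assms by (simp add: nil_D_obj_def comm_group_hom_group comm_group_comm_sub nil2_groupD
    bare_group.group_abelianization)

text \<open>The maps attached to a class are those of any representative, and the values of
  \<open>k\<close> lie in [H,H], where \<open>comm_map H \<beta>\<close> agrees with
  \<beta>.\<close>

lemma nil_D_map_apply:
  assumes "nil2_group G" "nil2_group H" "nil2_group G'" "nil2_group H'"
    and "\<alpha> \<in> Hom nil_cat G' G" "\<beta> \<in> Hom nil_cat H H'"
    and "k \<in> carrier (nil_D_obj (G, H))" "x \<in> carrier G'"
  shows "FMap nil_D (G, H) (G', H') (nil_sim G' G `` {\<alpha>}, nil_sim H H' `` {\<beta>}) k (ab_proj G' x)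
    = \<beta> (k (ab_proj G (\<alpha> x)))"
proof -
  interpret \<alpha>: bare_group_hom G' G \<alpha> using assms by (intro nil_cat_group_hom)
  show ?thesis
    using assms
    by (simp add: nil_D_def class_maps \<alpha>.ab_map_ab_proj \<alpha>.G.carrier_abelianization comm_map_def
        \<alpha>.H.nil_D_obj_carrier_iff)
qed

text \<open>Additivity is inherited from \<alpha>, \<open>k\<close> and \<beta>, and \<beta> maps
  [H,H] into [H',H'].\<close>

lemma nil_D_map_closed:
  assumes "nil2_group G" "nil2_group H" "nil2_group G'" "nil2_group H'"
    and "\<alpha> \<in> Hom nil_cat G' G" "\<beta> \<in> Hom nil_cat H H'"
    and "k \<in> carrier (nil_D_obj (G, H))"
  shows "FMap nil_D (G, H) (G', H') (nil_sim G' G `` {\<alpha>}, nil_sim H H' `` {\<beta>}) k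
    \<in> carrier (nil_D_obj (G', H'))"
proof -
  interpret \<alpha>: bare_group_hom G' G \<alpha> using assms by (intro nil_cat_group_hom)
  interpret \<beta>: bare_group_hom H H' \<beta> using assms by (intro nil_cat_group_hom)
  have "FMap nil_D (G, H) (G', H') (nil_sim G' G `` {\<alpha>}, nil_sim H H' `` {\<beta>}) k
      \<in> extensional (carrier (abelianization G'))"
    using assms by (simp add: nil_D_def)
  moreover have "k (ab_proj G x) \<in> carrier H" if "x \<in> carrier G" for x
    using assms that \<beta>.G.comm_sub_closed by (simp add: \<alpha>.H.nil_D_obj_carrier_iff)
  ultimately show ?thesis
    using assms \<beta>.comm_sub_image
    by (simp add: \<alpha>.G.nil_D_obj_carrier_iff nil_D_map_apply)
      (simp add: \<alpha>.H.nil_D_obj_carrier_iff)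
qed

text \<open>Products in D are pointwise, so additivity in \<open>k\<close> is the additivity of
  \<beta>.\<close>

lemma nil_D_map_in_Hom:
  assumes "nil2_group G" "nil2_group H" "nil2_group G'" "nil2_group H'"
    and "\<alpha> \<in> Hom nil_cat G' G" "\<beta> \<in> Hom nil_cat H H'"
  shows "FMap nil_D (G, H) (G', H') (nil_sim G' G `` {\<alpha>}, nil_sim H H' `` {\<beta>})
    \<in> Hom ab_cat (nil_D_obj (G, H)) (nil_D_obj (G', H'))" (is "?F \<in> _")
proof -
  interpret \<alpha>: bare_group_hom G' G \<alpha> using assms by (intro nil_cat_group_hom)
  interpret \<beta>: bare_group_hom H H' \<beta> using assms by (intro nil_cat_group_hom)
  interpret D: comm_group "nil_D_obj (G, H)" using assms by (intro comm_group_nil_D_obj)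
  interpret D': comm_group "nil_D_obj (G', H')" using assms by (intro comm_group_nil_D_obj)
  have "?F (k \<otimes>\<^bsub>nil_D_obj (G, H)\<^esub> l) = ?F k \<otimes>\<^bsub>nil_D_obj (G', H')\<^esub> ?F l"
    if kl: "k \<in> carrier (nil_D_obj (G, H))" "l \<in> carrier (nil_D_obj (G, H))" for k l
  proof (rule \<alpha>.G.nil_D_obj_ext)
    fix x assume x: "x \<in> carrier G'"
    have "k (ab_proj G (\<alpha> x)) \<in> carrier H" "l (ab_proj G (\<alpha> x)) \<in> carrier H"
      using kl x \<beta>.G.comm_sub_closed by (simp_all add: \<alpha>.H.nil_D_obj_carrier_iff)
    then show "?F (k \<otimes>\<^bsub>nil_D_obj (G, H)\<^esub> l) (ab_proj G' x)
        = (?F k \<otimes>\<^bsub>nil_D_obj (G', H')\<^esub> ?F l) (ab_proj G' x)"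
      using assms kl x
      by (simp add: nil_D_map_apply \<alpha>.G.nil_D_obj_mult \<alpha>.H.nil_D_obj_mult)
  qed (use assms kl nil_D_map_closed D.m_closed D'.m_closed in blast)+
  moreover have "?F \<in> extensional (carrier (nil_D_obj (G, H)))"
    by (simp add: nil_D_def)
  ultimately show ?thesis
    using assms nil_D_map_closed by (auto simp: ab_cat_def grp_cat_def hom_def)
qed

lemma FObj_nil_D: "FObj nil_D = nil_D_obj"
  by (simp add: nil_D_def)

lemma nil_sim_cat_simps:
  "Obj nil_sim_cat = {G. nil2_group G}"
  "Ident nil_sim_cat G = nil_sim G G `` {Ident nil_cat G}"
  by (simp_all add: nil_sim_cat_def nil.Obj_quotient_cat nil.Ident_quotient_cat nil_cat_simps)

text \<open>After the choice of representatives for the classes, each functor law compares two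
  elements of a group D(G,H) and is checked on cosets by \<open>nil_D_map_apply\<close>.\<close>

lemma cat_functor_nil_D:
  "cat_functor (prod_cat (op_cat nil_sim_cat) nil_sim_cat) ab_cat nil_D"
proof -
  let ?A = "prod_cat (op_cat nil_sim_cat) nil_sim_cat :: ('a monoid \<times> 'a monoid, _) cat"
  interpret A: category ?A
    unfolding nil_sim_cat_def
    by (intro category_prod_cat category_op_cat nil.quotient.category_axioms)
  interpret ab: category "ab_cat :: ('c monoid, _) cat"
    unfolding ab_cat_def by (rule category_grp_cat) (simp add: comm_group.axioms)
  \<comment> \<open>The first component of a morphism comes from the opposite category, so its
    representative \<alpha> runs from \<open>G'\<close> to \<open>G\<close>.\<close>
  have HomE: thesis
    if "f \<in> Hom ?A (G, H) (G', H')"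
      and "\<And>\<alpha> \<beta>. \<lbrakk>f = (nil_sim G' G `` {\<alpha>}, nil_sim H H' `` {\<beta>});
        \<alpha> \<in> Hom nil_cat G' G; \<beta> \<in> Hom nil_cat H H'\<rbrakk> \<Longrightarrow> thesis"
    for f G H G' H' thesis
    using that by (auto simp: prod_cat_def op_cat_def nil_sim_cat_def elim!: nil.Hom_classE)
  have Obj: "(G, H) \<in> Obj ?A \<longleftrightarrow> nil2_group G \<and> nil2_group H" for G H
    by (simp add: prod_cat_def op_cat_def nil_sim_cat_simps)
  show ?thesis
  proof
    fix X assume "X \<in> Obj ?A"
    then show "FObj nil_D X \<in> Obj ab_cat"
      by (cases X) (simp add: Obj nil_D_def ab_cat_def grp_cat_def comm_group_nil_D_obj)
  next
    fix X Y f assume "X \<in> Obj ?A" "Y \<in> Obj ?A" "f \<in> Hom ?A X Y"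
    then show "FMap nil_D X Y f \<in> Hom ab_cat (FObj nil_D X) (FObj nil_D Y)"
      by (cases X, cases Y) (auto simp: Obj nil_D_map_in_Hom FObj_nil_D elim!: HomE)
  next
    fix X assume X: "X \<in> Obj ?A"
    obtain G H where GH: "X = (G, H)" by (cases X)
    have nil: "nil2_group G" "nil2_group H" using X by (simp_all add: GH Obj)
    interpret G: bare_group G using nil by (intro nil2_groupD)
    interpret H: bare_group H using nil by (intro nil2_groupD)
    have id: "Ident nil_cat G \<in> Hom nil_cat G G" "Ident nil_cat H \<in> Hom nil_cat H H"
      using nil by (auto intro!: nil.Ident_in_Hom simp: nil_cat_simps(1))
    have "FMap nil_D X X (Ident ?A X) k = k" if k: "k \<in> carrier (nil_D_obj (G, H))" for k
    proof (rule G.nil_D_obj_ext[OF _ k])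
      show "FMap nil_D X X (Ident ?A X) k \<in> carrier (nil_D_obj (G, H))"
        using nil k id by (simp add: GH prod_cat_def op_cat_def nil_sim_cat_simps nil_D_map_closed)
      fix x assume "x \<in> carrier G"
      \<comment> \<open>The identity of \<open>H\<close> is the restricted one and can be evaluated
        only at elements of the carrier.\<close>
      moreover from this have "k (ab_proj G x) \<in> carrier H"
        using k H.comm_sub_closed by (simp add: G.nil_D_obj_carrier_iff)
      ultimately show "FMap nil_D X X (Ident ?A X) k (ab_proj G x) = k (ab_proj G x)"
        using nil k id
        by (simp add: GH prod_cat_def op_cat_def nil_sim_cat_simps nil_D_map_apply)
          (simp add: nil_cat_simps)
    qed
    moreover have "FMap nil_D X X (Ident ?A X) \<in> extensional (carrier (nil_D_obj (G, H)))"
      by (simp add: GH nil_D_def prod_cat_def)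
    ultimately show "FMap nil_D X X (Ident ?A X) = Ident ab_cat (FObj nil_D X)"
      by (intro extensionalityI[where A = "carrier (nil_D_obj (G, H))"])
        (simp_all add: ab_cat_def grp_cat_def GH FObj_nil_D)
  next
    fix X Y Z f g
    assume XYZ: "X \<in> Obj ?A" "Y \<in> Obj ?A" "Z \<in> Obj ?A"
      and fg: "f \<in> Hom ?A X Y" "g \<in> Hom ?A Y Z"
    obtain G H G' H' G'' H'' where GH: "X = (G, H)" "Y = (G', H')" "Z = (G'', H'')"
      by (cases X, cases Y, cases Z)
    have nil: "nil2_group G" "nil2_group H" "nil2_group G'" "nil2_group H'"
      "nil2_group G''" "nil2_group H''"
      using XYZ by (simp_all add: GH Obj)
    obtain \<alpha> \<beta> where f: "f = (nil_sim G' G `` {\<alpha>}, nil_sim H H' `` {\<beta>})"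
      and \<alpha>: "\<alpha> \<in> Hom nil_cat G' G" and \<beta>: "\<beta> \<in> Hom nil_cat H H'"
      using fg unfolding GH by (elim HomE) blast
    obtain \<alpha>' \<beta>' where g: "g = (nil_sim G'' G' `` {\<alpha>'}, nil_sim H' H'' `` {\<beta>'})"
      and \<alpha>': "\<alpha>' \<in> Hom nil_cat G'' G'" and \<beta>': "\<beta>' \<in> Hom nil_cat H' H''"
      using fg unfolding GH by (elim HomE) blast
    interpret \<alpha>: bare_group_hom G' G \<alpha> using nil \<alpha> by (intro nil_cat_group_hom)
    interpret \<alpha>': bare_group_hom G'' G' \<alpha>' using nil \<alpha>' by (intro nil_cat_group_hom)
    interpret H: bare_group H using nil by (intro nil2_groupD)
    let ?gf = "Comp ?A X Y Z g f"
    \<comment> \<open>The first components compose contravariantly, with \<alpha>' applied before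
      \<alpha>.\<close>
    have gf: "?gf = (nil_sim G'' G `` {Comp nil_cat G'' G' G \<alpha> \<alpha>'},
        nil_sim H H'' `` {Comp nil_cat H H' H'' \<beta>' \<beta>})"
      using nil \<alpha> \<beta> \<alpha>' \<beta>'
      by (simp add: GH f g prod_cat_def op_cat_def nil_sim_cat_def nil.Comp_classes nil_cat_simps(1))
    have comp: "Comp nil_cat G'' G' G \<alpha> \<alpha>' \<in> Hom nil_cat G'' G"
      "Comp nil_cat H H' H'' \<beta>' \<beta> \<in> Hom nil_cat H H''"
      using nil \<alpha> \<beta> \<alpha>' \<beta>' by (auto intro!: nil.Comp_in_Hom simp: nil_cat_simps(1))
    have "FMap nil_D X Z ?gf k = FMap nil_D Y Z g (FMap nil_D X Y f k)"
      if k: "k \<in> carrier (nil_D_obj (G, H))" for k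
    proof (rule \<alpha>'.G.nil_D_obj_ext)
      show "FMap nil_D X Z ?gf k \<in> carrier (nil_D_obj (G'', H''))"
        using nil k comp unfolding gf by (simp add: GH nil_D_map_closed)
      show "FMap nil_D Y Z g (FMap nil_D X Y f k) \<in> carrier (nil_D_obj (G'', H''))"
        using nil k \<alpha> \<beta> \<alpha>' \<beta>' by (simp add: GH f g nil_D_map_closed)
      fix x assume x: "x \<in> carrier G''"
      have "k (ab_proj G (\<alpha> (\<alpha>' x))) \<in> carrier H"
        using x k H.comm_sub_closed by (simp add: \<alpha>.H.nil_D_obj_carrier_iff)
      then show "FMap nil_D X Z ?gf k (ab_proj G'' x)
          = FMap nil_D Y Z g (FMap nil_D X Y f k) (ab_proj G'' x)"
        using nil k comp \<alpha> \<beta> \<alpha>' \<beta>' x unfolding gf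
        by (simp add: GH f g nil_D_map_apply nil_D_map_closed) (simp add: nil_cat_simps compose_eq)
    qed
    moreover have "FMap nil_D X Z ?gf \<in> extensional (carrier (nil_D_obj (G, H)))"
      by (simp add: GH nil_D_def gf[unfolded GH])
    ultimately show "FMap nil_D X Z ?gf
        = Comp ab_cat (FObj nil_D X) (FObj nil_D Y) (FObj nil_D Z) (FMap nil_D Y Z g) (FMap nil_D X Y f)"
      by (intro extensionalityI[where A = "carrier (nil_D_obj (G, H))"])
        (simp_all add: ab_cat_def grp_cat_def GH FObj_nil_D compose_eq)
  qed
qed


section \<open>The action\<close>

text \<open>The homomorphism into the bijections required by \<open>group_action\<close> encodes a
  left action, while \<open>mult\<close> states the law of a right action; for a commutative group
  the two coincide.\<close>

lemma comm_group_actionI: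
  assumes "comm_group D"
    and closed: "\<And>f a. \<lbrakk>f \<in> E; a \<in> carrier D\<rbrakk> \<Longrightarrow> act f a \<in> E"
    and one: "\<And>f. f \<in> E \<Longrightarrow> act f \<one>\<^bsub>D\<^esub> = f"
    and mult: "\<And>f a b. \<lbrakk>f \<in> E; a \<in> carrier D; b \<in> carrier D\<rbrakk>
      \<Longrightarrow> act f (a \<otimes>\<^bsub>D\<^esub> b) = act (act f a) b"
  shows "group_action D E (\<lambda>a. \<lambda>f\<in>E. act f a)"
proof -
  interpret D: comm_group D by fact
  have Bij: "(\<lambda>f\<in>E. act f a) \<in> Bij E" if a: "a \<in> carrier D" for a
  proof -
    have "bij_betw (\<lambda>f\<in>E. act f a) E E"
      \<comment> \<open>Acting by the inverse of \<open>a\<close> undoes acting by \<open>a\<close>,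
        in either order.\<close>
      by (rule bij_betw_byWitness[where f' = "\<lambda>f. act f (inv\<^bsub>D\<^esub> a)"])
        (use a closed in \<open>auto simp: one simp flip: mult\<close>)
    then show ?thesis by (simp add: Bij_def)
  qed
  \<comment> \<open>The composite acts by \<open>b\<close> first, whereas \<open>mult\<close> acts
    by \<open>a\<close> first; commutativity exchanges them.\<close>
  have "(\<lambda>f\<in>E. act f (a \<otimes>\<^bsub>D\<^esub> b)) = compose E (\<lambda>f\<in>E. act f a) (\<lambda>f\<in>E. act f b)"
    if "a \<in> carrier D" "b \<in> carrier D" for a b
    using that by (auto simp: fun_eq_iff compose_def closed D.m_comm[of a b] mult)
  then have "(\<lambda>a. \<lambda>f\<in>E. act f a) \<in> hom D (BijGroup E)"
    using Bij by (simp add: hom_def BijGroup_def)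
  then show ?thesis
    by (simp add: group_action_def group_hom_def group_hom_axioms_def group_BijGroup D.is_group)
qed

section \<open>The action of D(G,H) on homomorphisms\<close>

lemma nil_act_apply:
  "x \<in> carrier G \<Longrightarrow> nil_act G H f k x = f x \<otimes>\<^bsub>H\<^esub> k (ab_proj G x)"
  by (simp add: nil_act_def)

lemma Hom_nil_cat_ext:
  assumes "f \<in> Hom nil_cat G H" "g \<in> Hom nil_cat G H" "\<And>x. x \<in> carrier G \<Longrightarrow> f x = g x"
  shows "f = g"
  using assms by (auto simp: nil_cat_simps intro: extensionalityI)

lemma nil_act_closed:
  assumes "nil2_group G" "nil2_group H" "f \<in> Hom nil_cat G H" "k \<in> carrier (nil_D_obj (G, H))"
  shows "nil_act G H f k \<in> Hom nil_cat G H"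
proof -
  interpret f: bare_group_hom G H f using assms by (intro nil_cat_group_hom)
  have k: "k (ab_proj G x) \<in> comm_sub H" "k (ab_proj G x) \<in> carrier H" if "x \<in> carrier G" for x
    using assms that f.H.comm_sub_closed by (auto simp: f.G.nil_D_obj_carrier_iff)
  have "nil_act G H f k (x \<otimes>\<^bsub>G\<^esub> y) = nil_act G H f k x \<otimes>\<^bsub>H\<^esub> nil_act G H f k y"
    if xy: "x \<in> carrier G" "y \<in> carrier G" for x y
  proof -
    \<comment> \<open>The two sides of additivity differ only in the order of these two factors, and
      the value of \<open>k\<close> is central.\<close>
    have "f y \<otimes>\<^bsub>H\<^esub> k (ab_proj G x) = k (ab_proj G x) \<otimes>\<^bsub>H\<^esub> f y"
      using xy k assms by (intro nil2_group_central) auto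
    then have "f y \<otimes>\<^bsub>H\<^esub> (k (ab_proj G x) \<otimes>\<^bsub>H\<^esub> k (ab_proj G y))
        = k (ab_proj G x) \<otimes>\<^bsub>H\<^esub> (f y \<otimes>\<^bsub>H\<^esub> k (ab_proj G y))"
      using xy k by (simp flip: f.H.m_assoc)
    then show ?thesis
      using xy k assms by (simp add: nil_act_apply f.G.nil_D_obj_carrier_iff f.H.m_assoc)
  qed
  then show ?thesis
    using k by (auto simp: nil_cat_simps hom_def nil_act_apply) (simp add: nil_act_def)
qed

lemma nil_act_sim:
  assumes "nil2_group G" "nil2_group H" "f \<in> Hom nil_cat G H" "k \<in> carrier (nil_D_obj (G, H))"
  shows "(f, nil_act G H f k) \<in> nil_sim G H"
proof -
  interpret f: bare_group_hom G H f using assms by (intro nil_cat_group_hom)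
  have "ab_proj H (f x) = ab_proj H (nil_act G H f k x)" if "x \<in> carrier G" for x
    using assms that by (simp add: nil_act_apply f.G.nil_D_obj_carrier_iff f.H.ab_proj_mult_comm_sub)
  moreover have "nil_act G H f k c = f c" if c: "c \<in> comm_sub G" for c
  proof -
    \<comment> \<open>The value of \<open>k\<close> at the neutral coset, in which \<open>c\<close>
      lies, is idempotent in \<open>H\<close> and hence trivial.\<close>
    have "k (ab_proj G \<one>\<^bsub>G\<^esub>) \<in> carrier H"
      "k (ab_proj G (\<one>\<^bsub>G\<^esub> \<otimes>\<^bsub>G\<^esub> \<one>\<^bsub>G\<^esub>)) = k (ab_proj G \<one>\<^bsub>G\<^esub>) \<otimes>\<^bsub>H\<^esub> k (ab_proj G \<one>\<^bsub>G\<^esub>)"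
      using assms f.G.one_closed f.H.comm_sub_closed unfolding f.G.nil_D_obj_carrier_iff by blast+
    then have "k (ab_proj G \<one>\<^bsub>G\<^esub>) = \<one>\<^bsub>H\<^esub>" by simp
    moreover have "ab_proj G c = ab_proj G \<one>\<^bsub>G\<^esub>"
      using f.G.ab_proj_mult_comm_sub[OF f.G.one_closed c] c f.G.comm_sub_closed by simp
    ultimately show ?thesis
      using c f.G.comm_sub_closed by (simp add: nil_act_apply)
  qed
  ultimately show ?thesis
    using assms nil_act_closed by (simp add: nil_sim_iff)
qed

lemma nil_act_transitive:
  assumes "nil2_group G" "nil2_group H" "(f, g) \<in> nil_sim G H"
  shows "\<exists>k\<in>carrier (nil_D_obj (G, H)). nil_act G H f k = g"
proof -
  have f: "f \<in> Hom nil_cat G H" and g: "g \<in> Hom nil_cat G H"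
    and ab: "\<And>x. x \<in> carrier G \<Longrightarrow> ab_proj H (f x) = ab_proj H (g x)"
    and comm: "\<And>c. c \<in> comm_sub G \<Longrightarrow> f c = g c"
    using assms by (auto simp: nil_sim_iff)
  interpret f: bare_group_hom G H f using assms f by (intro nil_cat_group_hom)
  interpret g: bare_group_hom G H g using assms g by (intro nil_cat_group_hom)
  \<comment> \<open>The equation f + kp = g forces kp to be this difference.\<close>
  define d where "d x = inv\<^bsub>H\<^esub> f x \<otimes>\<^bsub>H\<^esub> g x" for x
  have d: "d x \<in> comm_sub H" "d x \<in> carrier H" "f x \<otimes>\<^bsub>H\<^esub> d x = g x" if "x \<in> carrier G" for x
    using that ab[OF that] by (auto simp: d_def f.H.ab_proj_eq_iff simp flip: f.H.m_assoc)
  have d_mult: "d (x \<otimes>\<^bsub>G\<^esub> y) = d x \<otimes>\<^bsub>H\<^esub> d y" if xy: "x \<in> carrier G" "y \<in> carrier G" for x y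
  proof -
    \<comment> \<open>Inverting the product \<open>f x\<close> times \<open>f y\<close> reverses its
      factors, which leaves \<open>d x\<close> enclosed between the terms in \<open>y\<close>; by
      centrality it can be moved to the front.\<close>
    have "d (x \<otimes>\<^bsub>G\<^esub> y) = inv\<^bsub>H\<^esub> f y \<otimes>\<^bsub>H\<^esub> d x \<otimes>\<^bsub>H\<^esub> g y"
      using xy by (simp add: d_def f.H.inv_mult_group f.H.m_assoc)
    also have "inv\<^bsub>H\<^esub> f y \<otimes>\<^bsub>H\<^esub> d x = d x \<otimes>\<^bsub>H\<^esub> inv\<^bsub>H\<^esub> f y"
      using xy d assms by (intro nil2_group_central) auto
    also have "d x \<otimes>\<^bsub>H\<^esub> inv\<^bsub>H\<^esub> f y \<otimes>\<^bsub>H\<^esub> g y = d x \<otimes>\<^bsub>H\<^esub> d y"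
      using xy d by (simp add: d_def[of y] f.H.m_assoc)
    finally show ?thesis .
  qed
  \<comment> \<open>This is where agreement on [G,G] enters: \<open>d\<close> is trivial there, so
    by additivity it is constant on cosets.\<close>
  have d_cong: "d x = d y" if xy: "x \<in> carrier G" "y \<in> carrier G" and eq: "ab_proj G x = ab_proj G y" for x y
  proof -
    define c where "c = inv\<^bsub>G\<^esub> x \<otimes>\<^bsub>G\<^esub> y"
    have c: "c \<in> comm_sub G" "c \<in> carrier G"
      using xy eq by (auto simp: c_def f.G.ab_proj_eq_iff)
    have "y = x \<otimes>\<^bsub>G\<^esub> c" using xy by (simp add: c_def flip: f.G.m_assoc)
    moreover have "d c = \<one>\<^bsub>H\<^esub>" using c by (simp add: d_def comm)
    ultimately show ?thesis using xy c d by (simp add: d_mult)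
  qed
  \<comment> \<open>The factorization of \<open>d\<close> through the abelianization; by
    \<open>d_cong\<close> the chosen representative does not matter.\<close>
  define k where "k = (\<lambda>z\<in>carrier (abelianization G). d (SOME x. x \<in> carrier G \<and> ab_proj G x = z))"
  have k: "k (ab_proj G x) = d x" if x: "x \<in> carrier G" for x
  proof -
    let ?y = "SOME y. y \<in> carrier G \<and> ab_proj G y = ab_proj G x"
    have "?y \<in> carrier G \<and> ab_proj G ?y = ab_proj G x"
      by (rule someI[of _ x]) (simp add: x)
    then have "d ?y = d x" using d_cong x by blast
    then show ?thesis using x by (simp add: k_def f.G.carrier_abelianization)
  qed
  have "k \<in> carrier (nil_D_obj (G, H))"
    using d d_mult by (simp add: f.G.nil_D_obj_carrier_iff k) (simp add: k_def)
  moreover from this have "nil_act G H f k = g"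
    using assms f g by (intro Hom_nil_cat_ext[OF nil_act_closed g]) (auto simp: nil_act_apply k d)
  ultimately show ?thesis by blast
qed

lemma nil_act_group_action:
  assumes "nil2_group G" "nil2_group H"
  shows "group_action (nil_D_obj (G, H)) (Hom nil_cat G H) (\<lambda>k. \<lambda>f\<in>Hom nil_cat G H. nil_act G H f k)"
proof -
  interpret D: comm_group "nil_D_obj (G, H)" using assms by (rule comm_group_nil_D_obj)
  interpret G: bare_group G using assms by (intro nil2_groupD)
  interpret H: bare_group H using assms by (intro nil2_groupD)
  have f: "f x \<in> carrier H" if "f \<in> Hom nil_cat G H" "x \<in> carrier G" for f x
    using that by (auto simp: nil_cat_simps hom_def)
  have k: "k (ab_proj G x) \<in> carrier H" if "k \<in> carrier (nil_D_obj (G, H))" "x \<in> carrier G" for k x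
    using that H.comm_sub_closed by (simp add: G.nil_D_obj_carrier_iff)
  show ?thesis
  proof (rule comm_group_actionI)
    fix f assume "f \<in> Hom nil_cat G H"
    then show "nil_act G H f \<one>\<^bsub>nil_D_obj (G, H)\<^esub> = f"
      using assms
      by (intro Hom_nil_cat_ext[where G = G and H = H])
        (simp_all add: nil_act_closed nil_act_apply G.nil_D_obj_one f)
  next
    fix f k l
    assume "f \<in> Hom nil_cat G H" "k \<in> carrier (nil_D_obj (G, H))" "l \<in> carrier (nil_D_obj (G, H))"
    then show "nil_act G H f (k \<otimes>\<^bsub>nil_D_obj (G, H)\<^esub> l) = nil_act G H (nil_act G H f k) l"
      using assms
      by (intro Hom_nil_cat_ext[where G = G and H = H])
        (simp_all add: nil_act_closed nil_act_apply G.nil_D_obj_mult f k H.m_assoc)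
  qed (use assms nil_act_closed D.comm_group_axioms in auto)
qed

text \<open>Cancelling \<open>f x\<close> in \<open>H\<close> shows that \<open>k\<close> is trivial
  at every coset.\<close>

lemma nil_act_free:
  assumes "nil2_group G" "nil2_group H" "f \<in> Hom nil_cat G H" "k \<in> carrier (nil_D_obj (G, H))"
    and "nil_act G H f k = f"
  shows "k = \<one>\<^bsub>nil_D_obj (G, H)\<^esub>"
proof -
  interpret f: bare_group_hom G H f using assms by (intro nil_cat_group_hom)
  interpret D: comm_group "nil_D_obj (G, H)" using assms by (intro comm_group_nil_D_obj)
  show ?thesis
  proof (rule f.G.nil_D_obj_ext)
    fix x assume x: "x \<in> carrier G"
    have "k (ab_proj G x) \<in> carrier H"
      using assms x f.H.comm_sub_closed by (simp add: f.G.nil_D_obj_carrier_iff)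
    moreover have "f x \<otimes>\<^bsub>H\<^esub> k (ab_proj G x) = f x"
      using x fun_cong[OF assms(5), of x] by (simp add: nil_act_apply)
    ultimately show "k (ab_proj G x) = \<one>\<^bsub>nil_D_obj (G, H)\<^esub> (ab_proj G x)"
      using x by (simp add: f.G.nil_D_obj_one)
  qed (use assms in auto)
qed

section \<open>Linear distributivity and the resulting extension\<close>

lemma nil_act_Comp:
  assumes nil: "nil2_group X" "nil2_group Y" "nil2_group Z"
    and \<beta>: "\<beta> \<in> Hom nil_cat X Y" and \<alpha>: "\<alpha> \<in> Hom nil_cat Y Z"
    and b: "b \<in> carrier (nil_D_obj (X, Y))" and a: "a \<in> carrier (nil_D_obj (Y, Z))"
  shows "Comp nil_cat X Y Z (nil_act Y Z \<alpha> a) (nil_act X Y \<beta> b)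
    = nil_act X Z (Comp nil_cat X Y Z \<alpha> \<beta>)
        (FMap nil_D (X, Y) (X, Z) (nil_sim X X `` {Ident nil_cat X}, nil_sim Y Z `` {\<alpha>}) b
          \<otimes>\<^bsub>nil_D_obj (X, Z)\<^esub>
         FMap nil_D (Y, Z) (X, Z) (nil_sim X Y `` {\<beta>}, nil_sim Z Z `` {Ident nil_cat Z}) a)"
    (is "_ = nil_act X Z _ (?b \<otimes>\<^bsub>_\<^esub> ?a)")
proof -
  interpret \<alpha>: bare_group_hom Y Z \<alpha> using nil \<alpha> by (intro nil_cat_group_hom)
  interpret \<beta>: bare_group_hom X Y \<beta> using nil \<beta> by (intro nil_cat_group_hom)
  interpret D: comm_group "nil_D_obj (X, Z)" using nil by (intro comm_group_nil_D_obj)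
  have obj: "X \<in> Obj nil_cat" "Y \<in> Obj nil_cat" "Z \<in> Obj nil_cat"
    using nil by (simp_all add: nil_cat_simps)
  have id: "Ident nil_cat X \<in> Hom nil_cat X X" "Ident nil_cat Z \<in> Hom nil_cat Z Z"
    using obj by (auto intro: nil.Ident_in_Hom)
  have ab: "?b \<in> carrier (nil_D_obj (X, Z))" "?a \<in> carrier (nil_D_obj (X, Z))"
    using nil \<alpha> \<beta> a b id by (auto intro!: nil_D_map_closed)
  show ?thesis
  proof (rule Hom_nil_cat_ext)
    show "Comp nil_cat X Y Z (nil_act Y Z \<alpha> a) (nil_act X Y \<beta> b) \<in> Hom nil_cat X Z"
      using nil \<alpha> \<beta> a b by (intro nil.Comp_in_Hom[OF obj] nil_act_closed)
    show "nil_act X Z (Comp nil_cat X Y Z \<alpha> \<beta>) (?b \<otimes>\<^bsub>nil_D_obj (X, Z)\<^esub> ?a) \<in> Hom nil_cat X Z"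
      using nil \<alpha> \<beta> ab by (intro nil.Comp_in_Hom[OF obj] nil_act_closed D.m_closed)
    fix x assume x: "x \<in> carrier X"
    have bx: "b (ab_proj X x) \<in> comm_sub Y" "b (ab_proj X x) \<in> carrier Y"
      using b x \<alpha>.G.comm_sub_closed by (auto simp: \<beta>.G.nil_D_obj_carrier_iff)
    have ax: "a (ab_proj Y (\<beta> x)) \<in> carrier Z"
      using a x \<alpha>.H.comm_sub_closed by (simp add: \<alpha>.G.nil_D_obj_carrier_iff)
    have "?b (ab_proj X x) = \<alpha> (b (ab_proj X x))"
      using nil id \<alpha> b x by (simp add: nil_D_map_apply) (simp add: nil_cat_simps)
    moreover have "?a (ab_proj X x) = a (ab_proj Y (\<beta> x))"
      using nil id \<beta> a x ax by (simp add: nil_D_map_apply) (simp add: nil_cat_simps)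
    \<comment> \<open>Both sides become the product of \<open>\<alpha> (\<beta> x)\<close>,
      \<open>\<alpha> (b (ab_proj X x))\<close> and \<open>a (ab_proj Y (\<beta> x))\<close>, in
      this order. On the left, \<open>a\<close> is evaluated at the coset of
      \<open>\<beta> x\<close> times a commutator element, which is the coset of
      \<open>\<beta> x\<close>.\<close>
    ultimately show "Comp nil_cat X Y Z (nil_act Y Z \<alpha> a) (nil_act X Y \<beta> b) x
        = nil_act X Z (Comp nil_cat X Y Z \<alpha> \<beta>) (?b \<otimes>\<^bsub>nil_D_obj (X, Z)\<^esub> ?a) x"
      using x bx ax
      by (simp add: nil_cat_simps(3) compose_eq nil_act_apply \<beta>.G.nil_D_obj_mult
          \<alpha>.G.ab_proj_mult_comm_sub \<alpha>.H.m_assoc)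
  qed
qed

theorem theorem5p4:
  shows "linear_extension
    (nil_D :: ('a monoid \<times> 'a monoid, ('a \<Rightarrow> 'a) set \<times> ('a \<Rightarrow> 'a) set,
      ('a set \<Rightarrow> 'a) monoid, ('a set \<Rightarrow> 'a) \<Rightarrow> 'a set \<Rightarrow> 'a) functor_data)
    nil_cat nil_sim_cat (quotient_functor nil_sim) nil_act"
proof -
  have FMap: "FMap (quotient_functor nil_sim) X Y f = nil_sim X Y `` {f}" for X Y :: "'a monoid" and f
    by (simp add: quotient_functor_def)
  have P: "cat_functor nil_cat nil_sim_cat
      (quotient_functor nil_sim :: ('a monoid, _, _, _) functor_data)"
    unfolding nil_sim_cat_def by (rule nil.quotient_functor.cat_functor_axioms)
  \<comment> \<open>The fibres of the quotient functor are thus the \<sim>-classes, to which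
    \<open>nil_act_transitive\<close> applies.\<close>
  have class_eq: "nil_sim X Y `` {f} = nil_sim X Y `` {g} \<longleftrightarrow> (f, g) \<in> nil_sim X Y"
    if "X \<in> Obj nil_cat" "Y \<in> Obj nil_cat" "f \<in> Hom nil_cat X Y" "g \<in> Hom nil_cat X Y"
    for X Y :: "'a monoid" and f g
    using eq_equiv_class_iff[OF nil.equiv_Hom] that by blast
  note nil_obj = nil_cat_simps(1)
  show ?thesis
  proof (intro linear_extension.intro linear_extension_axioms.intro cat_functor_nil_D P)
    fix X Y :: "'a monoid"
    assume XY: "X \<in> Obj nil_cat" "Y \<in> Obj nil_cat"
    show "FMap (quotient_functor nil_sim) X Y ` Hom nil_cat X Y = Hom nil_sim_cat X Y"
      unfolding nil_sim_cat_def by (rule nil.quotient_functor_full)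
    show "group_action (FObj nil_D (X, Y)) (Hom nil_cat X Y)
        (\<lambda>a. \<lambda>f\<in>Hom nil_cat X Y. nil_act X Y f a)"
      using XY by (simp add: FObj_nil_D nil_obj nil_act_group_action)
    fix f assume f: "f \<in> Hom nil_cat X Y"
    show "a = \<one>\<^bsub>FObj nil_D (X, Y)\<^esub>"
      if "a \<in> carrier (FObj nil_D (X, Y))" "nil_act X Y f a = f" for a
      using that XY f nil_act_free[of X Y f a] by (simp add: FObj_nil_D nil_obj)
    show "FMap (quotient_functor nil_sim) X Y (nil_act X Y f a) = FMap (quotient_functor nil_sim) X Y f"
      if "a \<in> carrier (FObj nil_D (X, Y))" for a
    proof -
      have "(f, nil_act X Y f a) \<in> nil_sim X Y"
        using that XY f nil_act_sim[of X Y f a] by (simp add: FObj_nil_D nil_obj)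
      then show ?thesis using equiv_class_eq[OF nil.equiv_Hom] XY by (metis FMap)
    qed
    show "\<exists>a\<in>carrier (FObj nil_D (X, Y)). nil_act X Y f a = g"
      if "g \<in> Hom nil_cat X Y"
        "FMap (quotient_functor nil_sim) X Y f = FMap (quotient_functor nil_sim) X Y g" for g
      using that XY f nil_act_transitive[of X Y f g] class_eq[of X Y f g]
      by (simp add: FObj_nil_D FMap nil_obj)
  next
    fix X Y Z :: "'a monoid" and \<beta> \<alpha> b a
    assume "X \<in> Obj nil_cat" "Y \<in> Obj nil_cat" "Z \<in> Obj nil_cat"
      "\<beta> \<in> Hom nil_cat X Y" "\<alpha> \<in> Hom nil_cat Y Z"
      "b \<in> carrier (FObj nil_D (X, Y))" "a \<in> carrier (FObj nil_D (Y, Z))"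
    then show "Comp nil_cat X Y Z (nil_act Y Z \<alpha> a) (nil_act X Y \<beta> b)
      = nil_act X Z (Comp nil_cat X Y Z \<alpha> \<beta>)
          (FMap nil_D (X, Y) (X, Z) (Ident nil_sim_cat X, FMap (quotient_functor nil_sim) Y Z \<alpha>) b
           \<otimes>\<^bsub>FObj nil_D (X, Z)\<^esub>
           FMap nil_D (Y, Z) (X, Z) (FMap (quotient_functor nil_sim) X Y \<beta>, Ident nil_sim_cat Z) a)"
      using nil_act_Comp[of X Y Z \<beta> \<alpha> b a] by (simp add: FObj_nil_D FMap nil_obj nil_sim_cat_simps(2))
  qed (simp_all add: nil_obj nil_sim_cat_simps(1) quotient_functor_def)
qed

end
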